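(* If $G$ is a finite group, then $$\Pr(G)\ \ge\ \frac{1}{|G'|}\left(1+\frac{|G'|-1}{|G:Z(G)|}\right).$$ In particular, $\Pr(G)>\frac{1}{|G'|}$ if $G$ is non-abelian.
   Context: For a finite group $G$: $\Pr(G)=|\{(x,y)\in G\times G: xy=yx\}|/|G|^2$ is the commutativity degree; $G'$ is the commutator subgroup; $Z(G)$ is the center. *)

theory Defs
  imports Complex_Main "HOL-Algebra.Algebra"
begin

definition group_center :: "('a, 'b) monoid_scheme \<Rightarrow> 'a set" where
  "group_center G =
     {z \<in> carrier G. \<forall>g\<in>carrier G. z \<otimes>\<^bsub>G\<^esub> g = g \<otimes>\<^bsub>G\<^esub> z}"

text \<open>Meaningful for groups with finite carrier only.\<close>

definition commutativity_degree :: "('a, 'b) monoid_scheme \<Rightarrow> real" where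
  "commutativity_degree G =
     real (card {(x, y) \<in> carrier G \<times> carrier G. x \<otimes>\<^bsub>G\<^esub> y = y \<otimes>\<^bsub>G\<^esub> x})
       / (real (order G))\<^sup>2"

definition subgroup_index :: "('a, 'b) monoid_scheme \<Rightarrow> 'a set \<Rightarrow> nat" where
  "subgroup_index G H = card (rcosets\<^bsub>G\<^esub> H)"

end

theory Submission
  imports Defs
begin

text \<open>
  Counting commuting pairs by their first entry, the number of them is
  \<open>\<Sum>x. card (C x)\<close>, where \<open>C x\<close> is the centralizer of \<open>x\<close>. For central \<open>x\<close> the centralizer
  is all of \<open>G\<close>. For any \<open>x\<close>, the map sending \<open>g\<close> to the commutator of \<open>g\<close> and \<open>x\<close> takes its values
  in the derived subgroup, and two elements with the same image differ by a factor in \<open>C x\<close>; hence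
  \<open>order G \<le> card G' * card (C x)\<close> (lemma \<open>order_le_derived_times_centralizer\<close>). Writing
  \<open>n\<close>, \<open>k\<close>, \<open>z\<close> for the sizes of \<open>G\<close>, \<open>G'\<close> and the center, the two bounds give at least
  \<open>z * n + (n - z) * (n / k)\<close> commuting pairs. Dividing by \<open>n\<^sup>2\<close> and using that the index of the
  center is \<open>n / z\<close> yields the inequality. For non-abelian \<open>G\<close> some commutator is nontrivial, so
  \<open>k > 1\<close> and the second summand of the bound is positive.
\<close>

text \<open>
  The centralizer in \<open>G\<close> of a single element. It is used only as a set: the counting argument
  does not need it to be a subgroup.
\<close>
definition centralizer :: "('a, 'b) monoid_scheme \<Rightarrow> 'a \<Rightarrow> 'a set" where
  "centralizer G x = {y \<in> carrier G. x \<otimes>\<^bsub>G\<^esub> y = y \<otimes>\<^bsub>G\<^esub> x}"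

context group
begin

lemma subgroup_group_center: "subgroup (group_center G) G"
proof (rule subgroupI)
  show "group_center G \<subseteq> carrier G"
    by (auto simp: group_center_def)
  show "group_center G \<noteq> {}"
    unfolding group_center_def using one_closed by force
next
  fix a assume "a \<in> group_center G"
  then have a: "a \<in> carrier G" and comm: "\<And>g. g \<in> carrier G \<Longrightarrow> a \<otimes> g = g \<otimes> a"
    by (auto simp: group_center_def)
  have "inv a \<otimes> g = g \<otimes> inv a" if g: "g \<in> carrier G" for g
  proof -
    have "g = g \<otimes> a \<otimes> inv a"
      using a g by (simp add: m_assoc)
    also have "\<dots> = a \<otimes> (g \<otimes> inv a)"
      using a g by (simp add: comm[OF g, symmetric] m_assoc)
    finally show ?thesis
      using a g inv_solve_left'[of a "inv a \<otimes> g" g] inv_solve_left[of "g \<otimes> inv a" a g] by auto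
  qed
  then show "inv a \<in> group_center G"
    using a by (simp add: group_center_def)
next
  fix a b assume "a \<in> group_center G" "b \<in> group_center G"
  then have ab: "a \<in> carrier G" "b \<in> carrier G"
    and comm: "\<And>g. g \<in> carrier G \<Longrightarrow> a \<otimes> g = g \<otimes> a" "\<And>g. g \<in> carrier G \<Longrightarrow> b \<otimes> g = g \<otimes> b"
    by (auto simp: group_center_def)
  have "a \<otimes> b \<otimes> g = g \<otimes> (a \<otimes> b)" if g: "g \<in> carrier G" for g
  proof -
    have "a \<otimes> b \<otimes> g = a \<otimes> g \<otimes> b"
      using ab g by (simp add: m_assoc comm(2)[OF g])
    also have "\<dots> = g \<otimes> (a \<otimes> b)"
      using ab g by (simp add: m_assoc comm(1)[OF g])
    finally show ?thesis .
  qed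
  then show "a \<otimes> b \<in> group_center G"
    using ab by (simp add: group_center_def)
qed

lemma commutator_in_derived:
  assumes "x \<in> carrier G" "y \<in> carrier G"
  shows "x \<otimes> y \<otimes> inv x \<otimes> inv y \<in> derived G (carrier G)"
  unfolding derived_def using assms by (intro generate.incl) auto

lemma commutator_eq_one_imp_commute:
  assumes x: "x \<in> carrier G" and y: "y \<in> carrier G"
    and "x \<otimes> y \<otimes> inv x \<otimes> inv y = \<one>"
  shows "x \<otimes> y = y \<otimes> x"
proof -
  have "x \<otimes> y \<otimes> inv (y \<otimes> x) = \<one>"
    using assms by (simp add: inv_mult_group m_assoc)
  then show ?thesis
    using x y inv_equality[of "x \<otimes> y" "inv (y \<otimes> x)"] by simp
qed

text \<open>
  This bounds the fibers of the commutator map: the fiber through \<open>g\<close> lies in the left coset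
  of the centralizer of \<open>x\<close> determined by \<open>g\<close>.
\<close>
lemma eq_commutators_imp_in_centralizer:
  assumes x: "x \<in> carrier G" and g: "g \<in> carrier G" and h: "h \<in> carrier G"
    and eq: "g \<otimes> x \<otimes> inv g \<otimes> inv x = h \<otimes> x \<otimes> inv h \<otimes> inv x"
  shows "inv g \<otimes> h \<in> centralizer G x"
proof -
  have conj: "g \<otimes> x \<otimes> inv g = h \<otimes> x \<otimes> inv h"
    using eq x g h right_cancel[of "inv x"] by simp
  have "x \<otimes> (inv g \<otimes> h) = inv g \<otimes> (g \<otimes> x \<otimes> inv g) \<otimes> h"
    using x g h by (simp add: m_assoc[symmetric])
  also have "\<dots> = inv g \<otimes> h \<otimes> x"
    unfolding conj using x g h by (simp add: m_assoc)
  finally show ?thesis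
    using g h by (simp add: centralizer_def)
qed

lemma order_le_derived_times_centralizer:
  assumes fin: "finite (carrier G)" and x: "x \<in> carrier G"
  shows "order G \<le> card (derived G (carrier G)) * card (centralizer G x)"
proof -
  define D where "D = derived G (carrier G)"
  define fiber where
    "fiber d = {g \<in> carrier G. g \<otimes> x \<otimes> inv g \<otimes> inv x = d}" for d
  have fin_D: "finite D"
    unfolding D_def using derived_in_carrier[of "carrier G"] fin finite_subset by blast
  have fin_C: "finite (centralizer G x)"
    using fin by (simp add: centralizer_def)
  have fiber_le: "card (fiber d) \<le> card (centralizer G x)" for d
  proof (cases "fiber d = {}")
    case False
    then obtain g where g: "g \<in> fiber d" by blast
    show ?thesis
      \<comment> \<open>left translation by the inverse of \<open>g\<close> injects the fiber into the centralizer\<close>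
    proof (rule card_inj_on_le[OF _ _ fin_C])
      show "inj_on (\<lambda>h. inv g \<otimes> h) (fiber d)"
        using g by (auto simp: fiber_def inj_on_def)
      show "(\<lambda>h. inv g \<otimes> h) ` fiber d \<subseteq> centralizer G x"
        using g x by (auto simp: fiber_def intro!: eq_commutators_imp_in_centralizer)
    qed
  qed simp
  have "carrier G \<subseteq> (\<Union>d\<in>D. fiber d)"
    unfolding D_def fiber_def using commutator_in_derived x by blast
  then have "order G \<le> card (\<Union>d\<in>D. fiber d)"
    unfolding order_def
    by (intro card_mono) (use fin fin_D in \<open>auto simp: fiber_def\<close>)
  also have "\<dots> \<le> (\<Sum>d\<in>D. card (fiber d))"
    by (rule card_UN_le[OF fin_D])
  also have "\<dots> \<le> card D * card (centralizer G x)"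
    using sum_bounded_above[of D "\<lambda>d. card (fiber d)", OF fiber_le] by simp
  finally show ?thesis
    unfolding D_def .
qed

lemma commutativity_degree_eq_sum_centralizer:
  assumes "finite (carrier G)"
  shows "commutativity_degree G =
           (\<Sum>x\<in>carrier G. real (card (centralizer G x))) / (real (order G))\<^sup>2"
proof -
  have "{(x, y) \<in> carrier G \<times> carrier G. x \<otimes> y = y \<otimes> x} = (SIGMA x:carrier G. centralizer G x)"
    by (auto simp: centralizer_def)
  then show ?thesis
    using assms by (simp add: commutativity_degree_def card_SigmaI centralizer_def)
qed

lemma derived_nontrivial:
  assumes fin: "finite (carrier G)" and "\<not> comm_group G"
  shows "card (derived G (carrier G)) > 1"
proof -
  obtain x y where xy: "x \<in> carrier G" "y \<in> carrier G" and "x \<otimes> y \<noteq> y \<otimes> x"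
    using assms group_comm_groupI by blast
  then have "x \<otimes> y \<otimes> inv x \<otimes> inv y \<noteq> \<one>"
    using commutator_eq_one_imp_commute by blast
  moreover have "\<one> \<in> derived G (carrier G)"
    unfolding derived_def by (rule generate.one)
  moreover have "finite (derived G (carrier G))"
    using derived_in_carrier[of "carrier G"] fin finite_subset by blast
  ultimately show ?thesis
    using commutator_in_derived[OF xy]
      card_mono[of "derived G (carrier G)" "{\<one>, x \<otimes> y \<otimes> inv x \<otimes> inv y}"]
    by auto
qed

end

theorem theorem2p4p1:
  fixes G :: "('a, 'b) monoid_scheme"
  assumes "group G" and "finite (carrier G)"
  shows "commutativity_degree G \<ge>
           1 / real (card (derived G (carrier G)))
             * (1 + (real (card (derived G (carrier G))) - 1)
                      / real (subgroup_index G (group_center G)))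
         \<and> (\<not> comm_group G \<longrightarrow>
              commutativity_degree G > 1 / real (card (derived G (carrier G))))"
proof -
  interpret group G by (rule assms(1))
  note fin = assms(2)
  define n where "n = real (order G)"
  define k where "k = real (card (derived G (carrier G)))"
  define z where "z = real (card (group_center G))"
  define i where "i = real (subgroup_index G (group_center G))"
  let ?Z = "group_center G"
  have Z_sub: "?Z \<subseteq> carrier G" and fin_Z: "finite ?Z"
    using fin by (auto simp: group_center_def)
  have n: "n > 0"
    using fin order_gt_0_iff_finite by (simp add: n_def)
  have iz: "i * z = n"
    using lagrange[OF subgroup_group_center]
    unfolding i_def z_def n_def subgroup_index_def by (metis of_nat_mult)
  have i: "i > 0"
    using iz n by (cases "i = 0") (auto simp: i_def)
  have bound: "n \<le> k * real (card (centralizer G x))" if "x \<in> carrier G" for x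
    using order_le_derived_times_centralizer[OF fin that]
    unfolding n_def k_def by (metis of_nat_le_iff of_nat_mult)
  have k: "k > 0"
    using bound[OF one_closed] n by (cases "k = 0") (auto simp: k_def)
  have "(\<Sum>x\<in>?Z. real (card (centralizer G x))) = (\<Sum>x\<in>?Z. n)"
  proof (rule sum.cong)
    fix x assume "x \<in> ?Z"
    then have "centralizer G x = carrier G"
      by (auto simp: centralizer_def group_center_def)
    then show "real (card (centralizer G x)) = n"
      by (simp add: n_def order_def)
  qed simp
  then have central: "(\<Sum>x\<in>?Z. real (card (centralizer G x))) = z * n"
    by (simp add: z_def)
  have "(\<Sum>x\<in>carrier G - ?Z. n / k) \<le> (\<Sum>x\<in>carrier G - ?Z. real (card (centralizer G x)))"
    using bound k by (intro sum_mono) (simp add: field_simps)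
  moreover have "real (card (carrier G - ?Z)) = n - z"
    using card_Diff_subset[OF fin_Z Z_sub] card_mono[OF fin Z_sub]
    by (simp add: n_def z_def order_def of_nat_diff)
  ultimately have noncentral:
    "(n - z) * (n / k) \<le> (\<Sum>x\<in>carrier G - ?Z. real (card (centralizer G x)))"
    by simp
  have "z * n + (n - z) * (n / k) \<le> (\<Sum>x\<in>carrier G. real (card (centralizer G x)))"
    using sum.subset_diff[OF Z_sub fin, of "\<lambda>x. real (card (centralizer G x))"]
      central noncentral by simp
  then have "(z * n + (n - z) * (n / k)) / n\<^sup>2 \<le> commutativity_degree G"
    using commutativity_degree_eq_sum_centralizer[OF fin]
    by (simp add: n_def divide_right_mono)
  moreover have "(z * n + (n - z) * (n / k)) / n\<^sup>2 = 1 / k * (1 + (k - 1) / i)"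
  proof -
    have "z > 0"
      using iz i n zero_less_mult_pos[of i z] by simp
    then show ?thesis
      unfolding iz[symmetric] using k i by (simp add: field_simps power2_eq_square)
  qed
  ultimately have main: "commutativity_degree G \<ge> 1 / k * (1 + (k - 1) / i)"
    by simp
  moreover have "commutativity_degree G > 1 / k" if "\<not> comm_group G"
  proof -
    have "k > 1"
      using derived_nontrivial[OF fin that] by (simp add: k_def)
    then have "1 / k * 1 < 1 / k * (1 + (k - 1) / i)"
      using i by (intro mult_strict_left_mono) auto
    then show ?thesis
      using main by simp
  qed
  ultimately show ?thesis
    unfolding k_def i_def by blast
qed

end
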